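(* Let $(A,\mu_A,\alpha_A,\beta_A)$ and $(B,\mu_B,\alpha_B,\beta_B)$ be two BiHom-alternative algebras. Then $(A\oplus B,\mu_{A\oplus B},\alpha_A+\alpha_B,\beta_A+\beta_B)$ is a BiHom-alternative algebra, where $$\mu_{A\oplus B}(a_1+b_1,a_2+b_2)=\mu_A(a_1,a_2)+\mu_B(b_1,b_2)\quad\text{for all } a_1,a_2\in A,\ b_1,b_2\in B,$$ and $(\alpha_A+\alpha_B)(a+b)=\alpha_A(a)+\alpha_B(b)$, $(\beta_A+\beta_B)(a+b)=\beta_A(a)+\beta_B(b)$ for all $(a,b)\in A\times B$.
   Context: $\mathbb{K}$ is an algebraically closed field of characteristic $0$; all vector spaces and (multi)linear maps are over $\mathbb{K}$. A BiHom-algebra $(A,\mu,\alpha,\beta)$ is a vector space $A$ with a bilinear map $\mu:A\times A\to A$ and linear maps $\alpha,\beta:A\to A$ with $\alpha\beta=\beta\alpha$. It is multiplicative if $\alpha(\mu(x,y))=\mu(\alpha(x),\alpha(y))$ and $\beta(\mu(x,y))=\mu(\beta(x),\beta(y))$ for all $x,y\in A$. Its BiHom-associator is $as_{\alpha,\beta}(x,y,z)=\mu(\mu(x,y),\beta(z))-\mu(\alpha(x),\mu(y,z))$. A BiHom-alternative algebra is a multiplicative BiHom-algebra satisfying, for all $x,y,z\in A$, $as_{\alpha,\beta}(\beta(x),\alpha(y),z)+as_{\alpha,\beta}(\beta(y),\alpha(x),z)=0$ and $as_{\alpha,\beta}(x,\beta(y),\alpha(z))+as_{\alpha,\beta}(x,\beta(z),\alpha(y))=0$.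 *)

theory Defs
  imports "HOL-Computational_Algebra.Polynomial" "HOL-Analysis.Product_Vector"
begin

locale bihom_algebra = vector_space scale
  for scale :: "'k::{alg_closed_field, field_char_0} \<Rightarrow> 'a::ab_group_add \<Rightarrow> 'a" +
  fixes \<mu> :: "'a \<Rightarrow> 'a \<Rightarrow> 'a" and \<alpha> \<beta> :: "'a \<Rightarrow> 'a"
  assumes linear_mult_left: "Vector_Spaces.linear scale scale (\<lambda>x. \<mu> x y)"
    and linear_mult_right: "Vector_Spaces.linear scale scale (\<lambda>y. \<mu> x y)"
    and linear_alpha: "Vector_Spaces.linear scale scale \<alpha>"
    and linear_beta: "Vector_Spaces.linear scale scale \<beta>"
    and alpha_beta_commute: "\<alpha> \<circ> \<beta> = \<beta> \<circ> \<alpha>"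
begin

definition bihom_associator :: "'a \<Rightarrow> 'a \<Rightarrow> 'a \<Rightarrow> 'a" where
  "bihom_associator x y z = \<mu> (\<mu> x y) (\<beta> z) - \<mu> (\<alpha> x) (\<mu> y z)"

end

locale multiplicative_bihom_algebra = bihom_algebra +
  assumes alpha_mult: "\<alpha> (\<mu> x y) = \<mu> (\<alpha> x) (\<alpha> y)"
    and beta_mult: "\<beta> (\<mu> x y) = \<mu> (\<beta> x) (\<beta> y)"

locale bihom_alternative_algebra = multiplicative_bihom_algebra +
  assumes left_alternative:
      "bihom_associator (\<beta> x) (\<alpha> y) z + bihom_associator (\<beta> y) (\<alpha> x) z = 0"
    and right_alternative:
      "bihom_associator x (\<beta> y) (\<alpha> z) + bihom_associator x (\<beta> z) (\<alpha> y) = 0"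

text \<open>
  The direct sum is carried by the product type: \<open>a + b\<close> with \<open>a\<close> in \<open>A\<close> and \<open>b\<close> in \<open>B\<close> is
  the pair \<open>(a, b)\<close>, and the scalar action is \<^const>\<open>module_prod.scale\<close>.
\<close>

definition direct_sum_mult ::
    "('a \<Rightarrow> 'a \<Rightarrow> 'a) \<Rightarrow> ('b \<Rightarrow> 'b \<Rightarrow> 'b) \<Rightarrow> 'a \<times> 'b \<Rightarrow> 'a \<times> 'b \<Rightarrow> 'a \<times> 'b" where
  "direct_sum_mult \<mu>\<^sub>A \<mu>\<^sub>B = (\<lambda>(a\<^sub>1, b\<^sub>1) (a\<^sub>2, b\<^sub>2). (\<mu>\<^sub>A a\<^sub>1 a\<^sub>2, \<mu>\<^sub>B b\<^sub>1 b\<^sub>2))"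

definition direct_sum_map :: "('a \<Rightarrow> 'a) \<Rightarrow> ('b \<Rightarrow> 'b) \<Rightarrow> 'a \<times> 'b \<Rightarrow> 'a \<times> 'b" where
  "direct_sum_map f g = (\<lambda>(a, b). (f a, g b))"

end

theory Submission
  imports Defs
begin

text \<open>The product, both structure maps, addition and the zero of the direct sum all act
  coordinate by coordinate, so every axiom is a pair of equations, one holding in A and one in B.
  For linearity this is \<open>linear_direct_sum_map\<close>, which also yields bilinearity of the
  product once one argument is frozen. For the alternative laws it is the fact
  \<open>associator\<close> in the main proof: the BiHom-associator of the sum is the pair of the
  BiHom-associators of A and B.\<close>

lemma linear_direct_sum_map:
  assumes "Vector_Spaces.linear sA sA f" "Vector_Spaces.linear sB sB g"
  shows "Vector_Spaces.linear (module_prod.scale sA sB) (module_prod.scale sA sB) (direct_sum_map f g)"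
proof -
  interpret f: Vector_Spaces.linear sA sA f by fact
  interpret g: Vector_Spaces.linear sB sB g by fact
  interpret prod: vector_space_prod sA sB ..
  show ?thesis
    unfolding Vector_Spaces.linear_iff
    \<comment> \<open>Linearity includes the claim that source and target are vector spaces; for the
      product this comes from \<open>prod\<close>.\<close>
    using f.vs1.vector_space_axioms g.vs1.vector_space_axioms prod.p.vector_space_axioms
    by (auto simp: direct_sum_map_def prod.scale_def f.add g.add f.scale g.scale)
qed

text \<open>Freezing one factor leaves a pair of multiplication maps, so linearity in the other
  factor becomes an instance of \<open>linear_direct_sum_map\<close>.\<close>

lemma direct_sum_mult_left:
  "(\<lambda>p. direct_sum_mult m n p q) = direct_sum_map (\<lambda>x. m x (fst q)) (\<lambda>y. n y (snd q))"
  by (auto simp: direct_sum_mult_def direct_sum_map_def fun_eq_iff split: prod.splits)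

lemma direct_sum_mult_right:
  "direct_sum_mult m n p = direct_sum_map (m (fst p)) (n (snd p))"
  by (auto simp: direct_sum_mult_def direct_sum_map_def fun_eq_iff split: prod.splits)

theorem proposition3p2:
  fixes scale\<^sub>A :: "'k::{alg_closed_field, field_char_0} \<Rightarrow> 'a::ab_group_add \<Rightarrow> 'a"
    and scale\<^sub>B :: "'k \<Rightarrow> 'b::ab_group_add \<Rightarrow> 'b"
    and \<mu>\<^sub>A :: "'a \<Rightarrow> 'a \<Rightarrow> 'a" and \<alpha>\<^sub>A \<beta>\<^sub>A :: "'a \<Rightarrow> 'a"
    and \<mu>\<^sub>B :: "'b \<Rightarrow> 'b \<Rightarrow> 'b" and \<alpha>\<^sub>B \<beta>\<^sub>B :: "'b \<Rightarrow> 'b"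
  assumes "bihom_alternative_algebra scale\<^sub>A \<mu>\<^sub>A \<alpha>\<^sub>A \<beta>\<^sub>A"
    and "bihom_alternative_algebra scale\<^sub>B \<mu>\<^sub>B \<alpha>\<^sub>B \<beta>\<^sub>B"
  shows "bihom_alternative_algebra (module_prod.scale scale\<^sub>A scale\<^sub>B)
    (direct_sum_mult \<mu>\<^sub>A \<mu>\<^sub>B) (direct_sum_map \<alpha>\<^sub>A \<alpha>\<^sub>B) (direct_sum_map \<beta>\<^sub>A \<beta>\<^sub>B)"
proof -
  interpret A: bihom_alternative_algebra scale\<^sub>A \<mu>\<^sub>A \<alpha>\<^sub>A \<beta>\<^sub>A by fact
  interpret B: bihom_alternative_algebra scale\<^sub>B \<mu>\<^sub>B \<alpha>\<^sub>B \<beta>\<^sub>B by fact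
  interpret prod: vector_space_prod scale\<^sub>A scale\<^sub>B ..
  \<comment> \<open>From here on the unqualified \<open>bihom_associator\<close> is that of the
    direct sum.\<close>
  interpret bihom_algebra prod.scale "direct_sum_mult \<mu>\<^sub>A \<mu>\<^sub>B"
    "direct_sum_map \<alpha>\<^sub>A \<alpha>\<^sub>B" "direct_sum_map \<beta>\<^sub>A \<beta>\<^sub>B"
  proof (intro bihom_algebra.intro bihom_algebra_axioms.intro prod.p.vector_space_axioms)
    show "direct_sum_map \<alpha>\<^sub>A \<alpha>\<^sub>B \<circ> direct_sum_map \<beta>\<^sub>A \<beta>\<^sub>B
        = direct_sum_map \<beta>\<^sub>A \<beta>\<^sub>B \<circ> direct_sum_map \<alpha>\<^sub>A \<alpha>\<^sub>B"
      using A.alpha_beta_commute B.alpha_beta_commute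
      by (auto simp: direct_sum_map_def fun_eq_iff)
    show "Vector_Spaces.linear prod.scale prod.scale (\<lambda>p. direct_sum_mult \<mu>\<^sub>A \<mu>\<^sub>B p q)" for q
      unfolding direct_sum_mult_left
      by (intro linear_direct_sum_map A.linear_mult_left B.linear_mult_left)
    show "Vector_Spaces.linear prod.scale prod.scale (direct_sum_mult \<mu>\<^sub>A \<mu>\<^sub>B p)" for p
      unfolding direct_sum_mult_right
      by (intro linear_direct_sum_map A.linear_mult_right B.linear_mult_right)
  qed (intro linear_direct_sum_map A.linear_alpha A.linear_beta B.linear_alpha B.linear_beta)+
  \<comment> \<open>The associator is built from the product, the structure maps and subtraction,
    all of them coordinatewise.\<close>
  have associator: "bihom_associator (a, b) (c, d) (e, f)
      = (A.bihom_associator a c e, B.bihom_associator b d f)" for a b c d e f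
    unfolding bihom_associator_def A.bihom_associator_def B.bihom_associator_def
    by (simp add: direct_sum_mult_def direct_sum_map_def)
  \<comment> \<open>Evaluates the maps only where they are applied to pairs. Unfolding
    \<open>direct_sum_map_def\<close> instead would also rewrite the maps that
    \<open>bihom_associator\<close> carries as parameters, and \<open>associator\<close> would no
    longer match.\<close>
  have map_Pair: "direct_sum_map f g (a, b) = (f a, g b)" for f g and a :: 'a and b :: 'b
    by (simp add: direct_sum_map_def)
  show ?thesis
  proof unfold_locales
    fix x y z :: "'a \<times> 'b"
    show "direct_sum_map \<alpha>\<^sub>A \<alpha>\<^sub>B (direct_sum_mult \<mu>\<^sub>A \<mu>\<^sub>B x y)
        = direct_sum_mult \<mu>\<^sub>A \<mu>\<^sub>B (direct_sum_map \<alpha>\<^sub>A \<alpha>\<^sub>B x) (direct_sum_map \<alpha>\<^sub>A \<alpha>\<^sub>B y)"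
      by (simp add: direct_sum_map_def direct_sum_mult_def A.alpha_mult B.alpha_mult
          split: prod.splits)
    show "direct_sum_map \<beta>\<^sub>A \<beta>\<^sub>B (direct_sum_mult \<mu>\<^sub>A \<mu>\<^sub>B x y)
        = direct_sum_mult \<mu>\<^sub>A \<mu>\<^sub>B (direct_sum_map \<beta>\<^sub>A \<beta>\<^sub>B x) (direct_sum_map \<beta>\<^sub>A \<beta>\<^sub>B y)"
      by (simp add: direct_sum_map_def direct_sum_mult_def A.beta_mult B.beta_mult
          split: prod.splits)
    show "bihom_associator (direct_sum_map \<beta>\<^sub>A \<beta>\<^sub>B x) (direct_sum_map \<alpha>\<^sub>A \<alpha>\<^sub>B y) z
        + bihom_associator (direct_sum_map \<beta>\<^sub>A \<beta>\<^sub>B y) (direct_sum_map \<alpha>\<^sub>A \<alpha>\<^sub>B x) z = 0"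
      \<comment> \<open>On explicit pairs the sum has the left alternative law of A in its first
        coordinate and that of B in its second.\<close>
      by (cases x; cases y; cases z)
        (simp add: map_Pair associator A.left_alternative B.left_alternative zero_prod_def)
    show "bihom_associator x (direct_sum_map \<beta>\<^sub>A \<beta>\<^sub>B y) (direct_sum_map \<alpha>\<^sub>A \<alpha>\<^sub>B z)
        + bihom_associator x (direct_sum_map \<beta>\<^sub>A \<beta>\<^sub>B z) (direct_sum_map \<alpha>\<^sub>A \<alpha>\<^sub>B y) = 0"
      by (cases x; cases y; cases z)
        (simp add: map_Pair associator A.right_alternative B.right_alternative zero_prod_def)
  qed
qed

end
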